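(* For $L$ and $M$ non-negative integers, we have \begin{equation*} \sum_{\substack{i,m\geq 0,\\ i+m\equiv 0\text{ (mod 2)}}} q^{\frac{m^2+3i^2}{2}} {L+M-i\brack L}_{q^3}{3(L-i)\brack m}_{q}{2(L-i)+\frac{i-m}{2}\brack 2(L-i)}_{q^3}=\sum_{j=-\infty}^\infty q^{3j^2+j}\, \mathcal{S}\left(L,M;\,2j,\,j;\,q^3\right). \end{equation*}
   Context: Here $|q|<1$, $(a;q)_n=(1-a)(1-aq)\cdots(1-aq^{n-1})$, and ${m+n \brack m}_q = \frac{(q;q)_{m+n}}{(q;q)_m(q;q)_n}$ for $m,n\geq 0$ and $0$ otherwise. The refined $q$-trinomial coefficient (Warnaar) is \[\mathcal{S}(L,M;\,a,b;\,q) := \sum_{n\geq0} q^{n(n+a)} {M+L-a-2n\brack M}_q {M-a+b \brack n}_q {M+a-b \brack n+a}_q.\] *)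

theory Defs
  imports "HOL-Analysis.Analysis"
begin

definition qpoch :: "complex \<Rightarrow> complex \<Rightarrow> nat \<Rightarrow> complex" where
  "qpoch a q n = (\<Prod>k<n. 1 - a * q ^ k)"

text \<open>\<open>qbinom q N m\<close> is the bracket with upper entry \<open>N\<close>, lower entry \<open>m\<close> and base \<open>q\<close>.
  The entries are integers, as the bracket also occurs with negative entries, where it is \<open>0\<close>:
  writing \<open>N = m + n\<close>, the condition \<open>m, n \<ge> 0\<close> reads \<open>0 \<le> m \<le> N\<close>.
  For \<open>norm q < 1\<close> the denominator does not vanish.\<close>

definition qbinom :: "complex \<Rightarrow> int \<Rightarrow> int \<Rightarrow> complex" where
  "qbinom q N m =
     (if 0 \<le> m \<and> m \<le> N
      then qpoch q q (nat N) / (qpoch q q (nat m) * qpoch q q (nat (N - m)))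
      else 0)"

text \<open>The exponent \<open>n(n+a)\<close> is negative only if \<open>n + a < 0\<close>, and then the last bracket is \<open>0\<close>;
  so the value \<open>0\<close> of negative powers of \<open>0\<close> plays no role.\<close>

definition qtrinom :: "int \<Rightarrow> int \<Rightarrow> int \<Rightarrow> int \<Rightarrow> complex \<Rightarrow> complex" where
  "qtrinom L M a b q =
     (\<Sum>\<^sub>\<infinity>n::nat. q powi (int n * (int n + a)) * qbinom q (M + L - a - 2 * int n) M
        * qbinom q (M - a + b) (int n) * qbinom q (M + a - b) (int n + a))"

text \<open>All sums below have only finitely many nonzero terms, so that the unconditional infinite
  sums are ordinary finite sums, and the value \<open>0\<close> of non-summable families is never used.\<close>

lemma qbinom_neg: "m < 0 \<or> N < m \<Longrightarrow> qbinom q N m = 0"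
  by (auto simp: qbinom_def)

lemma qtrinom_finite_support:
  "finite {n::nat. q powi (int n * (int n + a)) * qbinom q (M + L - a - 2 * int n) M
        * qbinom q (M - a + b) (int n) * qbinom q (M + a - b) (int n + a) \<noteq> 0}"
proof (rule finite_subset)
  show "{n::nat. q powi (int n * (int n + a)) * qbinom q (M + L - a - 2 * int n) M
        * qbinom q (M - a + b) (int n) * qbinom q (M + a - b) (int n + a) \<noteq> 0}
      \<subseteq> {..nat (M - a + b)}"
    by (auto simp: qbinom_def split: if_splits)
qed simp

lemma lhs_finite_support:
  fixes L M :: nat
  shows "finite {(i :: nat, m :: nat).
      q ^ ((m^2 + 3 * i^2) div 2)
      * qbinom (q^3) (int L + int M - int i) (int L)
      * qbinom q (3 * (int L - int i)) (int m)
      * qbinom (q^3) (2 * (int L - int i) + (int i - int m) div 2) (2 * (int L - int i)) \<noteq> 0}"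
proof (rule finite_subset)
  show "{(i :: nat, m :: nat).
      q ^ ((m^2 + 3 * i^2) div 2)
      * qbinom (q^3) (int L + int M - int i) (int L)
      * qbinom q (3 * (int L - int i)) (int m)
      * qbinom (q^3) (2 * (int L - int i) + (int i - int m) div 2) (2 * (int L - int i)) \<noteq> 0}
     \<subseteq> {..L} \<times> {..3 * L}"
    by (auto simp: qbinom_def split: if_splits)
qed simp

lemma qtrinom_eq_0:
  assumes "\<bar>j\<bar> > M"
  shows "qtrinom L M (2 * j) j q = 0"
proof -
  have "qbinom q (M - 2 * j + j) (int n) * qbinom q (M + 2 * j - j) (int n + 2 * j) = 0" for n
    using assms by (auto simp: qbinom_def)
  thus ?thesis
    unfolding qtrinom_def by (intro infsum_0) (auto simp: mult.assoc)
qed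

lemma rhs_finite_support:
  "finite {j :: int. q powi (3 * j^2 + j) * qtrinom L M (2 * j) j (q^3) \<noteq> 0}"
proof (rule finite_subset)
  show "{j :: int. q powi (3 * j^2 + j) * qtrinom L M (2 * j) j (q^3) \<noteq> 0} \<subseteq> {-M..M}"
    using qtrinom_eq_0[of M _ L "q^3"] by (force simp: not_less[symmetric])
qed simp

end

(*
Write p = q^3, N = L - i and let g be a square root of q. Grouping the factors of
prod_{k < 3N} (1 + x g^(2k+1)) by k mod 3 expresses g^(m^2) [3N, m]_q as a threefold convolution of
p-binomial coefficients, which turns the left-hand side into a sum over a, k, l with i = a + k + l:
the q-Pfaff-Saalschuetz sum collapses the summation that links b = k - r and c = l - r to k and l.
Collecting the terms with l - k = j, the claim becomes, for each j, Warnaar's transformation of the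
refined q-trinomial coefficients. By symmetry j >= 0. Then part of the summand is itself the value of
a Saalschuetz sum over a new index w; after this expansion the k-sum and finally the w-sum can be
evaluated by the same formula, which leaves the single sum defining S(L, M; 2j, j).
*)
theory Submission
  imports Defs
begin

section \<open>The q-Pfaff-Saalschuetz sum\<close>

text \<open>Extending the factorial by \<open>1\<close> and its reciprocal by \<open>0\<close> to negative arguments makes the
  factorization of the q-binomial coefficients and the recurrence of \<open>rqfac\<close> hold for all integers, so
  that no ranges of summation need to be tracked.\<close>

definition qfac :: "complex \<Rightarrow> int \<Rightarrow> complex" where
  "qfac p n = qpoch p p (nat n)"

definition rqfac :: "complex \<Rightarrow> int \<Rightarrow> complex" where
  "rqfac p n = (if n < 0 then 0 else 1 / qfac p n)"

lemma qfac_nonzero: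
  assumes "norm p < 1"
  shows "qfac p n \<noteq> 0"
proof -
  have "1 - p * p ^ k \<noteq> 0" for k
  proof
    assume "1 - p * p ^ k = 0"
    hence "norm (p ^ Suc k) = 1" by simp
    moreover have "norm (p ^ Suc k) < 1"
      unfolding norm_power using assms by (intro power_less_one_iff[THEN iffD2]) auto
    ultimately show False by simp
  qed
  thus ?thesis by (simp add: qfac_def qpoch_def)
qed

lemma rqfac_neg [simp]: "n < 0 \<Longrightarrow> rqfac p n = 0"
  by (simp add: rqfac_def)

lemma qfac_mult_rqfac:
  assumes "norm p < 1" "n \<ge> 0"
  shows "qfac p n * rqfac p n = 1"
  using assms qfac_nonzero[of p n] by (simp add: rqfac_def)

lemma qfac_0 [simp]: "qfac p 0 = 1" "rqfac p 0 = 1"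
  by (simp_all add: qfac_def rqfac_def qpoch_def)

lemma qfac_rec:
  assumes "n > 0"
  shows "qfac p n = (1 - p powi n) * qfac p (n - 1)"
proof -
  obtain k where k: "n = int (Suc k)"
    using assms by (metis gr0_implies_Suc nat_0_less_mult_iff pos_int_cases)
  have "nat n = Suc k" "nat (n - 1) = k" by (simp_all add: k)
  thus ?thesis by (simp add: k qfac_def qpoch_def power_int_def nat_add_distrib)
qed

text \<open>At \<open>n = 0\<close> the factor \<open>1 - p powi 0 = 0\<close> matches
  \<open>rqfac p (-1) = 0\<close>, and for \<open>n < 0\<close> both sides vanish. This is why the
  reciprocal satisfies the recurrence at every integer, whereas \<open>qfac_rec\<close> needs
  \<open>n > 0\<close>.\<close>

lemma rqfac_rec:
  assumes "norm p < 1"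
  shows "rqfac p (n - 1) = (1 - p powi n) * rqfac p n"
proof (cases "n > 0")
  case True
  have "1 - p powi n \<noteq> 0"
    using qfac_rec[OF True, of p] qfac_nonzero[OF assms, of n] by auto
  thus ?thesis using True by (simp add: rqfac_def qfac_rec[OF True, of p])
next
  case False
  thus ?thesis by (cases "n = 0") auto
qed

lemma qbinom_eq: "qbinom p N m = qfac p N * rqfac p m * rqfac p (N - m)"
  by (simp add: qbinom_def rqfac_def qfac_def)

text \<open>A Wilf-Zeilberger pair: \<open>f\<close> is the summand divided by the part of the closed form that depends
  on \<open>c\<close>, and \<open>h\<close> is its certificate.\<close>

lemma saalschuetz_step:
  fixes p :: complex and u v c e t :: int
  assumes p: "p \<noteq> 0" "norm p < 1" and ge: "u \<ge> 0" "v \<ge> 0" "c \<ge> 0" "e \<ge> 0"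
  defines "f \<equiv> \<lambda>c t. p powi (t * (t + e)) * qfac p (u + v + c + e - t) * rqfac p t * rqfac p (t + e)
                 * rqfac p (u - t) * rqfac p (v - t) * rqfac p (c - t)
                 * qfac p c * qfac p (c + e) * rqfac p (u + c + e) * rqfac p (v + c + e)"
  defines "h \<equiv> \<lambda>t. p powi (c + 1 - t) * p powi (t * (t + e)) * qfac p (u + v + c + e + 1 - t)
                 * rqfac p (t - 1) * rqfac p (t + e - 1)
                 * rqfac p (u - t) * rqfac p (v - t) * rqfac p (c + 1 - t)
                 * qfac p c * qfac p (c + e) * rqfac p (u + c + e + 1) * rqfac p (v + c + e + 1)"
  shows "f (c + 1) t - f c t = h t - h (t + 1)"
proof (cases "t \<le> u \<and> t \<le> v \<and> t \<le> c + 1")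
  \<comment> \<open>Each of the four terms then contains a reciprocal factorial of a negative
    argument.\<close>
  case False
  thus ?thesis unfolding f_def h_def by auto
next
  case True
  \<comment> \<open>\<open>K\<close> collects the factors common to all four terms. By the
    recurrences each term is \<open>K\<close> times a polynomial in \<open>a\<close>,
    \<open>b\<close>, \<open>d\<close>, \<open>E\<close> and \<open>T\<close>, so that a polynomial
    identity remains.\<close>
  define K where "K = p powi (t * (t + e)) * qfac p (u + v + c + e - t) * rqfac p t * rqfac p (t + e)
      * rqfac p (u - t) * rqfac p (v - t) * rqfac p (c + 1 - t) * qfac p c * qfac p (c + e)
      * rqfac p (u + c + e + 1) * rqfac p (v + c + e + 1)"
  define a where "a = p powi (u - t)"
  define b where "b = p powi (v - t)"
  define d where "d = p powi (c + 1 - t)"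
  define E where "E = p powi e"
  define T where "T = p powi t"
  note pw = power_int_add[of p, OF disjI1[OF p(1)], symmetric]
  have e1: "p powi (u + v + c + e + 1 - t) = a * b * d * T * T * E"
    unfolding a_def b_def d_def E_def T_def pw by (simp add: algebra_simps)
  have e2: "p powi (c + 1) = d * T" "p powi (c + 1 + e) = d * T * E"
    unfolding d_def E_def T_def pw by (simp_all add: algebra_simps)
  have e3: "p powi (u + c + e + 1) = a * d * T * T * E" "p powi (v + c + e + 1) = b * d * T * T * E"
    unfolding a_def b_def d_def E_def T_def pw by (simp_all add: algebra_simps)
  have e4: "p powi (c + 1 - (t + 1)) * p powi ((t + 1) * (t + 1 + e)) = d * T * T * E * p powi (t * (t + e))"
    unfolding d_def E_def T_def pw by (simp add: algebra_simps)
  have e5: "p powi (t + e) = T * E" unfolding E_def T_def pw ..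
  have q1: "qfac p (u + v + c + e + 1 - t) = (1 - a * b * d * T * T * E) * qfac p (u + v + c + e - t)"
    using qfac_rec[of "u + v + c + e + 1 - t" p] True ge unfolding e1
    by (simp add: algebra_simps)
  have q2: "qfac p (c + 1) = (1 - d * T) * qfac p c"
    using qfac_rec[of "c + 1" p] ge unfolding e2 by simp
  have q3: "qfac p (c + 1 + e) = (1 - d * T * E) * qfac p (c + e)"
    using qfac_rec[of "c + 1 + e" p] ge unfolding e2 by simp
  have r1: "rqfac p (t - 1) = (1 - T) * rqfac p t" "rqfac p (t + e - 1) = (1 - T * E) * rqfac p (t + e)"
    using rqfac_rec[OF p(2), of t] rqfac_rec[OF p(2), of "t + e"] by (simp_all add: e5 T_def)
  have r2: "rqfac p (u - (t + 1)) = (1 - a) * rqfac p (u - t)" "rqfac p (v - (t + 1)) = (1 - b) * rqfac p (v - t)"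
     "rqfac p (c - t) = (1 - d) * rqfac p (c + 1 - t)"
    using rqfac_rec[OF p(2), of "u - t"] rqfac_rec[OF p(2), of "v - t"] rqfac_rec[OF p(2), of "c + 1 - t"]
    by (simp_all add: a_def b_def d_def algebra_simps)
  have r3: "rqfac p (u + c + e) = (1 - a * d * T * T * E) * rqfac p (u + c + e + 1)"
    "rqfac p (v + c + e) = (1 - b * d * T * T * E) * rqfac p (v + c + e + 1)"
    using rqfac_rec[OF p(2), of "u + c + e + 1"] rqfac_rec[OF p(2), of "v + c + e + 1"] by (simp_all add: e3)
  have i1: "u + v + (c + 1) + e - t = u + v + c + e + 1 - t" "u + (c + 1) + e = u + c + e + 1"
     "v + (c + 1) + e = v + c + e + 1" "u + v + c + e + 1 - (t + 1) = u + v + c + e - t"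
     "t + 1 - 1 = t" "t + 1 + e - 1 = t + e" "c + 1 - (t + 1) = c - t" by simp_all
  have f1: "f (c + 1) t = (1 - a * b * d * T * T * E) * (1 - d * T) * (1 - d * T * E) * K"
    unfolding f_def K_def i1 q1 q2 q3 by (simp only: mult_ac)
  have f2: "f c t = (1 - d) * (1 - a * d * T * T * E) * (1 - b * d * T * T * E) * K"
    unfolding f_def K_def r3 r2 by (simp only: mult_ac)
  have h1: "h t = d * (1 - a * b * d * T * T * E) * (1 - T) * (1 - T * E) * K"
    unfolding h_def K_def q1 r1 d_def[symmetric] by (simp only: mult_ac)
  have h2: "h (t + 1) = d * T * T * E * (1 - a) * (1 - b) * (1 - d) * K"
    unfolding h_def K_def e4 i1(4-6) r2(1,2) unfolding i1(7) r2(3) by (simp only: mult_ac)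
  show ?thesis unfolding f1 f2 h1 h2 by (simp only: flip: left_diff_distrib) algebra
qed

text \<open>Summed over \<open>t\<close>, the Wilf-Zeilberger relation telescopes to
  \<open>0\<close>. Hence the normalized sum does not depend on \<open>c\<close>, and its value is
  read off at \<open>c = 0\<close>, where only \<open>t = 0\<close> contributes.\<close>

lemma saalschuetz_nat:
  fixes p :: complex and u v e :: int and c :: nat
  assumes p: "p \<noteq> 0" "norm p < 1" and ge: "u \<ge> 0" "v \<ge> 0" "e \<ge> 0"
  shows "(\<Sum>t\<le>c. p powi (int t * (int t + e)) * qfac p (u + v + int c + e - int t)
            * rqfac p (int t) * rqfac p (int t + e)
            * rqfac p (u - int t) * rqfac p (v - int t) * rqfac p (int c - int t))
       = qfac p (u + v + e) * qfac p (u + int c + e) * qfac p (v + int c + e)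
            * rqfac p u * rqfac p v * rqfac p (int c)
            * rqfac p (u + e) * rqfac p (v + e) * rqfac p (int c + e)"
proof -
  define f :: "int \<Rightarrow> int \<Rightarrow> complex" where "f c t = p powi (t * (t + e)) * qfac p (u + v + c + e - t) * rqfac p t * rqfac p (t + e)
                 * rqfac p (u - t) * rqfac p (v - t) * rqfac p (c - t)
                 * qfac p c * qfac p (c + e) * rqfac p (u + c + e) * rqfac p (v + c + e)" for c t :: int
  note [simp] = qfac_mult_rqfac[OF p(2)]
  have "(\<Sum>t\<le>c. f (int c) (int t)) = qfac p (u + v + e) * rqfac p u * rqfac p v * rqfac p (u + e) * rqfac p (v + e)"
  proof (induction c)
    case 0
    have "qfac p e * rqfac p e = 1" using ge by simp
    thus ?case by (simp add: f_def mult.commute[of "rqfac p e"])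
  next
    case (Suc c)
    define h :: "int \<Rightarrow> complex" where "h t = p powi (int c + 1 - t) * p powi (t * (t + e)) * qfac p (u + v + c + e + 1 - t)
                 * rqfac p (t - 1) * rqfac p (t + e - 1)
                 * rqfac p (u - t) * rqfac p (v - t) * rqfac p (c + 1 - t)
                 * qfac p c * qfac p (c + e) * rqfac p (u + c + e + 1) * rqfac p (v + c + e + 1)" for t :: int
    have step: "f (int (Suc c)) (int t) - f (int c) (int t) = h (int t) - h (int (Suc t))" for t
      using saalschuetz_step[OF p ge(1,2) _ ge(3), of "int c" "int t"]
      unfolding f_def h_def by (simp add: add_ac)
    have "(\<Sum>t\<le>Suc c. f (int (Suc c)) (int t)) - (\<Sum>t\<le>Suc c. f (int c) (int t))
        = (\<Sum>t<Suc (Suc c). h (int t) - h (int (Suc t)))"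
      unfolding sum_subtractf[symmetric] step by (simp add: lessThan_Suc_atMost)
    also have "\<dots> = h 0 - h (int (Suc (Suc c)))"
      by (subst sum_lessThan_telescope') simp
    \<comment> \<open>Both boundary terms contain \<open>rqfac p (-1)\<close>: at \<open>0\<close>
      it comes from \<open>t - 1\<close>, at \<open>c + 2\<close> from
      \<open>c + 1 - t\<close>.\<close>
    also have "\<dots> = 0" by (simp add: h_def)
    also have "(\<Sum>t\<le>Suc c. f (int c) (int t)) = (\<Sum>t\<le>c. f (int c) (int t))"
      by (simp add: f_def)
    finally show ?case using Suc.IH by simp
  qed
  \<comment> \<open>\<open>W\<close> is the normalization that \<open>f\<close> carries in addition
    to the summand \<open>g\<close>, and \<open>V\<close> is its reciprocal.\<close>
  moreover define W where "W = qfac p c * qfac p (c + e) * rqfac p (u + c + e) * rqfac p (v + c + e)"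
  moreover define V where "V = rqfac p c * rqfac p (c + e) * qfac p (u + c + e) * qfac p (v + c + e)"
  moreover define g :: "int \<Rightarrow> complex" where "g t = p powi (t * (t + e)) * qfac p (u + v + int c + e - t)
            * rqfac p t * rqfac p (t + e) * rqfac p (u - t) * rqfac p (v - t) * rqfac p (int c - t)" for t :: int
  ultimately have "(\<Sum>t\<le>c. g (int t)) * W
      = qfac p (u + v + e) * rqfac p u * rqfac p v * rqfac p (u + e) * rqfac p (v + e)"
    unfolding sum_distrib_right by (simp add: f_def mult_ac)
  moreover have "W * V = 1"
  proof -
    have "W * V = (qfac p c * rqfac p c) * (qfac p (c + e) * rqfac p (c + e))
        * (qfac p (u + c + e) * rqfac p (u + c + e)) * (qfac p (v + c + e) * rqfac p (v + c + e))"
      by (simp add: W_def V_def mult_ac)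
    thus ?thesis using ge by simp
  qed
  ultimately have "(\<Sum>t\<le>c. g (int t))
      = qfac p (u + v + e) * rqfac p u * rqfac p v * rqfac p (u + e) * rqfac p (v + e) * V"
    by (metis mult.assoc mult.right_neutral)
  thus ?thesis unfolding g_def V_def by (simp only: mult_ac)
qed

text \<open>With \<open>r = m - t\<close> this is \<open>saalschuetz_nat\<close> for
  \<open>u = d1 + m\<close>, \<open>v = d2 + m\<close>, \<open>c = d3 + m\<close>,
  \<open>e = n - m\<close>. The form is symmetric in the \<open>d\<close>'s, and \<open>I\<close>
  may be any finite set containing the support, so that later applications need no adjustment of
  ranges.\<close>

lemma saalschuetz_aux:
  fixes p :: complex and d1 d2 d3 m n :: int
  assumes p: "p \<noteq> 0" "norm p < 1" and I: "finite I"
    "\<And>r. -d1 \<le> r \<Longrightarrow> -d2 \<le> r \<Longrightarrow> -d3 \<le> r \<Longrightarrow> r \<le> m \<Longrightarrow> r \<le> n \<Longrightarrow> r \<in> I"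
    and mn: "m \<le> n"
  shows "(\<Sum>r\<in>I. p powi ((m - r) * (n - r)) * qfac p (d1 + d2 + d3 + m + n + r)
            * rqfac p (d1 + r) * rqfac p (d2 + r) * rqfac p (d3 + r) * rqfac p (m - r) * rqfac p (n - r))
       = qfac p (d1 + d2 + m + n) * qfac p (d1 + d3 + m + n) * qfac p (d2 + d3 + m + n)
            * rqfac p (d1 + m) * rqfac p (d2 + m) * rqfac p (d3 + m)
            * rqfac p (d1 + n) * rqfac p (d2 + n) * rqfac p (d3 + n)" (is "sum ?f I = ?R")
proof (cases "d1 + m \<ge> 0 \<and> d2 + m \<ge> 0 \<and> d3 + m \<ge> 0")
  case False
  have "?f r = 0" for r
    \<comment> \<open>If \<open>r \<le> m\<close>, then a negative \<open>d + m\<close> forces a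
      negative \<open>d + r\<close>; otherwise \<open>m - r\<close> is negative.\<close>
    using False by (cases "d1 + r < 0 \<or> d2 + r < 0 \<or> d3 + r < 0 \<or> m - r < 0") auto
  hence "sum ?f I = 0" by (intro sum.neutral ballI)
  also have "0 = ?R" using False by auto
  finally show ?thesis .
next
  case True
  \<comment> \<open>\<open>J\<close> is the range of \<open>r = m - t\<close> for
    \<open>0 \<le> t \<le> d3 + m\<close>. Summands outside \<open>I \<inter> J\<close> vanish, so
    the sums over \<open>I\<close> and over \<open>J\<close> agree.\<close>
  define J where "J = (\<lambda>t. m - int t) ` {..nat (d3 + m)}"
  have zero: "?f r = 0" if "r \<notin> I \<inter> J" for r
  proof (rule ccontr)
    assume nz: "?f r \<noteq> 0"
    hence r: "-d1 \<le> r" "-d2 \<le> r" "-d3 \<le> r" "r \<le> m" "r \<le> n"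
      by (auto simp: not_less[symmetric] simp del: not_less intro: ccontr)
    hence "r \<in> I" using I(2) by blast
    moreover have "r \<in> J" unfolding J_def using r
      by (intro image_eqI[of _ _ "nat (m - r)"]) auto
    ultimately show False using that by blast
  qed
  have "finite J" by (simp add: J_def)
  have "sum ?f I = sum ?f (I \<inter> J)"
    by (rule sum.mono_neutral_right) (use I zero in auto)
  also have "\<dots> = sum ?f J"
    by (rule sum.mono_neutral_left) (use \<open>finite J\<close> zero in auto)
  also have "\<dots> = (\<Sum>t\<le>nat (d3 + m). ?f (m - int t))"
    unfolding J_def by (subst sum.reindex) (auto simp: inj_on_def)
  also have "\<dots> = ?R"
  proof -
    define c where "c = nat (d3 + m)"
    have c: "int c = d3 + m" using True by (simp add: c_def)
    have "?R = (\<Sum>t\<le>c. p powi (int t * (int t + (n - m))) * qfac p ((d1 + m) + (d2 + m) + int c + (n - m) - int t)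
            * rqfac p (int t) * rqfac p (int t + (n - m))
            * rqfac p ((d1 + m) - int t) * rqfac p ((d2 + m) - int t) * rqfac p (int c - int t))"
      by (subst saalschuetz_nat[OF p]) (use True mn in \<open>simp_all add: c algebra_simps\<close>)
    also have "\<dots> = (\<Sum>t\<le>c. ?f (m - int t))"
      by (rule sum.cong) (simp_all add: c algebra_simps)
    finally show ?thesis by (simp add: c_def)
  qed
  finally show ?thesis .
qed

text \<open>Both sides are symmetric in \<open>m\<close> and \<open>n\<close>, which removes the
  ordering assumption.\<close>

lemma saalschuetz:
  fixes p :: complex and d1 d2 d3 m n :: int
  assumes p: "p \<noteq> 0" "norm p < 1" and I: "finite I"
    "\<And>r. -d1 \<le> r \<Longrightarrow> -d2 \<le> r \<Longrightarrow> -d3 \<le> r \<Longrightarrow> r \<le> m \<Longrightarrow> r \<le> n \<Longrightarrow> r \<in> I"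
  shows "(\<Sum>r\<in>I. p powi ((m - r) * (n - r)) * qfac p (d1 + d2 + d3 + m + n + r)
            * rqfac p (d1 + r) * rqfac p (d2 + r) * rqfac p (d3 + r) * rqfac p (m - r) * rqfac p (n - r))
       = qfac p (d1 + d2 + m + n) * qfac p (d1 + d3 + m + n) * qfac p (d2 + d3 + m + n)
            * rqfac p (d1 + m) * rqfac p (d2 + m) * rqfac p (d3 + m)
            * rqfac p (d1 + n) * rqfac p (d2 + n) * rqfac p (d3 + n)"
proof (cases "m \<le> n")
  case True
  thus ?thesis using saalschuetz_aux[OF p I] by simp
next
  case False
  have "(\<Sum>r\<in>I. p powi ((n - r) * (m - r)) * qfac p (d1 + d2 + d3 + n + m + r)
            * rqfac p (d1 + r) * rqfac p (d2 + r) * rqfac p (d3 + r) * rqfac p (n - r) * rqfac p (m - r))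
       = qfac p (d1 + d2 + n + m) * qfac p (d1 + d3 + n + m) * qfac p (d2 + d3 + n + m)
            * rqfac p (d1 + n) * rqfac p (d2 + n) * rqfac p (d3 + n)
            * rqfac p (d1 + m) * rqfac p (d2 + m) * rqfac p (d3 + m)"
    by (rule saalschuetz_aux[OF p I(1)]) (use I(2) False in auto)
  thus ?thesis by (simp add: ac_simps)
qed

text \<open>The substitution of \<open>-r\<close> for \<open>r\<close> gives the shape that fits the
  \<open>k\<close>-sum and the \<open>w\<close>-sum of the transformation below.\<close>

lemma saalschuetz_reflected:
  fixes p :: complex and d1 d2 d3 m n :: int
  assumes p: "p \<noteq> 0" "norm p < 1" and I: "finite I"
    "\<And>r. r \<le> d1 \<Longrightarrow> r \<le> d2 \<Longrightarrow> r \<le> d3 \<Longrightarrow> -m \<le> r \<Longrightarrow> -n \<le> r \<Longrightarrow> r \<in> I"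
  shows "(\<Sum>r\<in>I. p powi ((m + r) * (n + r)) * qfac p (d1 + d2 + d3 + m + n - r)
            * rqfac p (d1 - r) * rqfac p (d2 - r) * rqfac p (d3 - r) * rqfac p (m + r) * rqfac p (n + r))
       = qfac p (d1 + d2 + m + n) * qfac p (d1 + d3 + m + n) * qfac p (d2 + d3 + m + n)
            * rqfac p (d1 + m) * rqfac p (d2 + m) * rqfac p (d3 + m)
            * rqfac p (d1 + n) * rqfac p (d2 + n) * rqfac p (d3 + n)"
proof -
  have "r \<in> uminus ` I" if "-d1 \<le> r" "-d2 \<le> r" "-d3 \<le> r" "r \<le> m" "r \<le> n" for r
    by (rule image_eqI[of _ _ "-r"]) (use that in \<open>auto intro!: I(2)\<close>)
  from saalschuetz[OF p finite_imageI[OF I(1)] this] show ?thesis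
    by (simp add: sum.reindex)
qed

section \<open>The transformation of refined q-trinomial coefficients\<close>

text \<open>Up to factors depending on \<open>T\<close> and \<open>j\<close> only, six factorials of the summand form the value of a
  Saalschuetz sum over \<open>w\<close>; \<open>h\<close> is the triple summand that results from expanding them.\<close>

lemma trinomial_transformation_nonneg:
  fixes p :: complex and L M j :: int
  assumes p: "p \<noteq> 0" "norm p < 1" and ge: "L \<ge> 0" "M \<ge> 0" "j \<ge> 0"
  shows "(\<Sum>T\<in>{0..L}. \<Sum>k\<in>{0..L}. p powi (T\<^sup>2 + k\<^sup>2 + T * j + k * j)
            * qbinom p (L + M - (T + k + j)) L * qbinom p (L - (T + k + j)) (T - k)
            * qbinom p (L - T) k * qbinom p (L - T - j) (k + j))
       = (\<Sum>n\<in>{0..L}. p powi (n * (n + 2 * j)) * qbinom p (M + L - 2 * j - 2 * n) M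
            * qbinom p (M - j) n * qbinom p (M + j) (n + 2 * j))"
    (is "(\<Sum>T\<in>?I. \<Sum>k\<in>?I. ?a T k) = (\<Sum>n\<in>?I. ?d n)")
proof -
  note pw = power_int_add[of p, OF disjI1[OF p(1)], symmetric]
  note inv = qfac_mult_rqfac[OF p(2)]
  define h where "h T k w = qfac p j * qfac p T * rqfac p (T + j)
     * (p powi ((T - k - w) * (j - w)) * qfac p (L - j - T + w) * rqfac p w * rqfac p (k + w) * rqfac p (L - 2 * j - 2 * T + w)
        * rqfac p (T - k - w) * rqfac p (j - w))
     * (p powi (T\<^sup>2 + k\<^sup>2 + T * j + k * j)
        * qfac p (L + M - T - j - k) * rqfac p L * rqfac p (M - T - j - k) * qfac p (L - T) * rqfac p k * rqfac p (L - T - k))" for T k w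
  define b where "b T w = p powi (T\<^sup>2 + 2 * T * j - T * w - w * j + w\<^sup>2) * qfac p j * rqfac p (T + j)
      * qfac p (L - j - T + w) * rqfac p w * rqfac p (L - 2 * j - 2 * T + w) * rqfac p (j - w)
      * qfac p (M - j) * qfac p (L + M - 2 * T - j + w) * rqfac p (T - w)
      * rqfac p (M - T - j) * rqfac p (M - T - j + w) * rqfac p (L - T + w)" for T w
  have a: "?a T k = (\<Sum>w\<in>?I. h T k w)" if "T \<in> ?I" "k \<in> ?I" for T k
  proof -
    have s: "(\<Sum>w\<in>?I. p powi ((T - k - w) * (j - w)) * qfac p (L - j - T + w) * rqfac p w * rqfac p (k + w) * rqfac p (L - 2 * j - 2 * T + w)
        * rqfac p (T - k - w) * rqfac p (j - w))
      = qfac p (T + j) * qfac p (L - j - T - k) * qfac p (L - T - j)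
        * rqfac p (T - k) * rqfac p T * rqfac p (L - 2 * j - T - k) * rqfac p j * rqfac p (k + j) * rqfac p (L - j - 2 * T)"
      using saalschuetz[OF p, of ?I 0 k "L - 2 * j - 2 * T" "T - k" j] that
      by (simp add: algebra_simps)
    \<comment> \<open>The first three pairs cancel to \<open>1\<close> because \<open>j\<close>,
      \<open>T\<close> and \<open>T + j\<close> are nonnegative; this is where
      \<open>j \<ge> 0\<close> enters the expansion.\<close>
    have "(\<Sum>w\<in>?I. h T k w) = (qfac p j * rqfac p j) * (qfac p T * rqfac p T) * (qfac p (T + j) * rqfac p (T + j))
      * (qfac p (L - j - T - k) * qfac p (L - T - j)
        * rqfac p (T - k) * rqfac p (L - 2 * j - T - k) * rqfac p (k + j) * rqfac p (L - j - 2 * T))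
      * (p powi (T\<^sup>2 + k\<^sup>2 + T * j + k * j)
        * qfac p (L + M - T - j - k) * rqfac p L * rqfac p (M - T - j - k) * qfac p (L - T) * rqfac p k * rqfac p (L - T - k))"
      unfolding h_def sum_distrib_left[symmetric] sum_distrib_right[symmetric] s by (simp only: mult_ac)
    also have "\<dots> = ?a T k"
      using that ge by (simp add: inv qbinom_eq algebra_simps)
    finally show ?thesis ..
  qed
  have hb: "(\<Sum>k\<in>?I. h T k w) = b T w" if "T \<in> ?I" "w \<in> ?I" for T w
  proof -
    have s: "(\<Sum>k\<in>?I. p powi (k * (w + k)) * qfac p (L + M - T - j - k) * rqfac p (T - w - k)
         * rqfac p (M - T - j - k) * rqfac p (L - T - k) * rqfac p k * rqfac p (w + k))
      = qfac p (M - j) * qfac p L * qfac p (L + M - 2 * T - j + w)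
        * rqfac p (T - w) * rqfac p (M - T - j) * rqfac p (L - T) * rqfac p T * rqfac p (M - T - j + w) * rqfac p (L - T + w)"
      using saalschuetz_reflected[OF p, of ?I "T - w" "M - T - j" "L - T" 0 w] that
      by (simp add: algebra_simps)
    \<comment> \<open>The terms \<open>k * j\<close> cancel, and the part depending on
      \<open>k\<close> is exactly the exponent \<open>k * (w + k)\<close> of the reflected
      formula.\<close>
    have e: "p powi ((T - k - w) * (j - w)) * p powi (T\<^sup>2 + k\<^sup>2 + T * j + k * j)
       = p powi (T\<^sup>2 + 2 * T * j - T * w - w * j + w\<^sup>2) * p powi (k * (w + k))" for k
      unfolding pw by (simp add: algebra_simps power2_eq_square)
    have "h T k w = (p powi ((T - k - w) * (j - w)) * p powi (T\<^sup>2 + k\<^sup>2 + T * j + k * j)) *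
       (qfac p j * qfac p T * rqfac p (T + j) * qfac p (L - j - T + w) * rqfac p w * rqfac p (L - 2 * j - 2 * T + w)
        * rqfac p (j - w) * rqfac p L * qfac p (L - T))
      * (qfac p (L + M - T - j - k) * rqfac p (T - w - k)
         * rqfac p (M - T - j - k) * rqfac p (L - T - k) * rqfac p k * rqfac p (w + k))" for k
      unfolding h_def by (simp add: algebra_simps)
    hence "(\<Sum>k\<in>?I. h T k w) = (p powi (T\<^sup>2 + 2 * T * j - T * w - w * j + w\<^sup>2)
       * qfac p j * qfac p T * rqfac p (T + j) * qfac p (L - j - T + w) * rqfac p w * rqfac p (L - 2 * j - 2 * T + w)
        * rqfac p (j - w) * rqfac p L * qfac p (L - T))
      * (\<Sum>k\<in>?I. p powi (k * (w + k)) * qfac p (L + M - T - j - k) * rqfac p (T - w - k)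
         * rqfac p (M - T - j - k) * rqfac p (L - T - k) * rqfac p k * rqfac p (w + k))"
      unfolding e sum_distrib_left by (simp add: mult_ac)
    also have "\<dots> = (qfac p T * rqfac p T) * (qfac p L * rqfac p L) * (qfac p (L - T) * rqfac p (L - T)) * b T w"
      unfolding s b_def by (simp only: mult_ac)
    also have "\<dots> = b T w"
      using that by (simp add: inv)
    finally show ?thesis .
  qed
  \<comment> \<open>After the substitution \<open>T = n + w\<close> the exponent separates into
    \<open>n * (n + 2 * j)\<close> and \<open>w * (n + j + w)\<close>. The first is the exponent of
    the refined q-trinomial coefficient, the second makes the \<open>w\<close>-sum a Saalschuetz
    sum.\<close>
  have bd: "(\<Sum>w\<in>?I. b (n + w) w) = ?d n" if "n \<in> ?I" for n
  proof -
    have s: "(\<Sum>w\<in>?I. p powi (w * (n + j + w)) * qfac p (L + M - 2 * n - j - w) * rqfac p (j - w)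
         * rqfac p (M - j - n - w) * rqfac p (L - 2 * j - 2 * n - w) * rqfac p w * rqfac p (n + j + w))
      = qfac p (M + j) * qfac p (L - n) * qfac p (L + M - 2 * j - 2 * n)
        * rqfac p j * rqfac p (M - j - n) * rqfac p (L - 2 * j - 2 * n) * rqfac p (n + 2 * j) * rqfac p M * rqfac p (L - j - n)"
      using saalschuetz_reflected[OF p, of ?I j "M - j - n" "L - 2 * j - 2 * n" 0 "n + j"] that ge
      by (simp add: algebra_simps)
    have e: "p powi ((n + w)\<^sup>2 + 2 * (n + w) * j - (n + w) * w - w * j + w\<^sup>2)
       = p powi (n * (n + 2 * j)) * p powi (w * (n + j + w))" for w
      unfolding pw by (simp add: algebra_simps power2_eq_square)
    have "(\<Sum>w\<in>?I. b (n + w) w) = (p powi (n * (n + 2 * j)) * qfac p j * qfac p (L - j - n) * qfac p (M - j)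
        * rqfac p n * rqfac p (M - n - j) * rqfac p (L - n))
      * (\<Sum>w\<in>?I. p powi (w * (n + j + w)) * qfac p (L + M - 2 * n - j - w) * rqfac p (j - w)
         * rqfac p (M - j - n - w) * rqfac p (L - 2 * j - 2 * n - w) * rqfac p w * rqfac p (n + j + w))"
      unfolding b_def e sum_distrib_left
      by (intro sum.cong refl) (simp add: algebra_simps)
    also have "\<dots> = (qfac p j * rqfac p j) * (qfac p (L - n) * rqfac p (L - n)) * (p powi (n * (n + 2 * j)) * qfac p (M - j)
        * rqfac p n * rqfac p (M - n - j)) * (qfac p (L - j - n) * rqfac p (L - j - n)
      * qfac p (M + j) * qfac p (L + M - 2 * j - 2 * n)
        * rqfac p (M - j - n) * rqfac p (L - 2 * j - 2 * n) * rqfac p (n + 2 * j) * rqfac p M)"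
      unfolding s by (simp only: mult_ac)
    also have "\<dots> = ?d n"
      \<comment> \<open>If \<open>L - j - n < 0\<close>, its factorials do not cancel, but then
        \<open>L - 2 * j - 2 * n\<close> is negative too and both sides are
        \<open>0\<close>.\<close>
      using that ge by (cases "L - j - n \<ge> 0") (auto simp add: inv qbinom_eq algebra_simps)
    finally show ?thesis .
  qed
  have "(\<Sum>T\<in>?I. \<Sum>k\<in>?I. ?a T k) = (\<Sum>T\<in>?I. \<Sum>k\<in>?I. \<Sum>w\<in>?I. h T k w)"
    using a by simp
  also have "\<dots> = (\<Sum>T\<in>?I. \<Sum>w\<in>?I. b T w)"
    by (subst sum.swap, intro sum.cong refl) (use hb in simp)
  also have "\<dots> = (\<Sum>w\<in>?I. \<Sum>T\<in>?I. b T w)"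
    by (rule sum.swap)
  also have "\<dots> = (\<Sum>w\<in>?I. \<Sum>n\<in>?I. b (n + w) w)"
  proof (rule sum.cong[OF refl])
    fix w assume w: "w \<in> ?I"
    \<comment> \<open>For \<open>T < w\<close> the factor \<open>rqfac p (T - w)\<close> vanishes.
      For \<open>T > L\<close> it is \<open>rqfac p (L - 2 * j - 2 * T + w)\<close> if
      \<open>w \<le> j\<close>, and \<open>rqfac p (j - w)\<close> otherwise. So the range of
      \<open>T\<close> may be shifted by \<open>w\<close>.\<close>
    have "b T w = 0" if "T < w \<or> T > L" for T
      using that ge w by (cases "w \<le> j") (auto simp: b_def)
    hence "(\<Sum>T\<in>?I. b T w) = (\<Sum>T\<in>{w..L+w}. b T w)"
      by (intro sum.mono_neutral_cong) (use w in auto)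
    also have "\<dots> = (\<Sum>n\<in>?I. b (n + w) w)"
      by (rule sum.reindex_bij_witness[of _ "\<lambda>n. n + w" "\<lambda>T. T - w"]) auto
    finally show "(\<Sum>T\<in>?I. b T w) = (\<Sum>n\<in>?I. b (n + w) w)" .
  qed
  also have "\<dots> = (\<Sum>n\<in>?I. \<Sum>w\<in>?I. b (n + w) w)"
    by (rule sum.swap)
  also have "\<dots> = (\<Sum>n\<in>?I. ?d n)"
    using bd by simp
  finally show ?thesis .
qed

section \<open>Splitting the q-binomial coefficients with upper entry \<open>3N\<close>\<close>

lemma qbinom_pascal:
  assumes "p \<noteq> 0" "norm p < 1" "N \<ge> 0"
  shows "qbinom p (N + 1) m = qbinom p N m + p powi (N + 1 - m) * qbinom p N (m - 1)"
proof -
  have 1: "rqfac p (m - 1) = (1 - p powi m) * rqfac p m"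
    by (rule rqfac_rec) fact
  have 2: "rqfac p (N - m) = (1 - p powi (N + 1 - m)) * rqfac p (N + 1 - m)"
    using rqfac_rec[OF assms(2), of "N + 1 - m"] by (simp add: algebra_simps)
  have 3: "qfac p (N + 1) = (1 - p powi (N + 1 - m) * p powi m) * qfac p N"
    using qfac_rec[of "N + 1" p] assms by (simp flip: power_int_add)
  have 4: "N - (m - 1) = N + 1 - m" by simp
  show ?thesis unfolding qbinom_eq 4 1 2 3 by (simp add: algebra_simps)
qed

text \<open>The finite q-binomial theorem, by induction from the Pascal rule. Working with a square
  root \<open>g\<close> of the base keeps the exponents integral; the scale \<open>c\<close> serves
  the three residue classes modulo 3 below.\<close>

lemma qbinomial_theorem_coeff:
  fixes g c :: complex
  assumes g: "g \<noteq> 0" "norm g < 1"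
  shows "coeff (\<Prod>k<N. [:1, c * g ^ (2 * k + 1):]) m = c ^ m * g ^ (m\<^sup>2) * qbinom (g\<^sup>2) (int N) (int m)"
proof (induction N arbitrary: m)
  case 0
  thus ?case by (cases m) (auto simp: qbinom_def qpoch_def)
next
  case (Suc N)
  have p: "g\<^sup>2 \<noteq> 0" "norm (g\<^sup>2) < 1"
    using g by (auto simp: norm_power power_less_one_iff)
  define P where "P = (\<Prod>k<N. [:1, c * g ^ (2 * k + 1):])"
  have eq: "(\<Prod>k<Suc N. [:1, c * g ^ (2 * k + 1):]) = P + pCons 0 (smult (c * g ^ (2 * N + 1)) P)"
    unfolding P_def by simp
  note IH = Suc.IH[folded P_def]
  have pas: "qbinom (g\<^sup>2) (int (Suc N)) m
      = qbinom (g\<^sup>2) (int N) m + (g\<^sup>2) powi (int N + 1 - m) * qbinom (g\<^sup>2) (int N) (m - 1)" for m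
    using qbinom_pascal[OF p, of "int N" m] by (simp add: add_ac)
  show ?case
  proof (cases m)
    case 0
    thus ?thesis unfolding eq pas using IH[of 0] by (simp add: qbinom_neg)
  next
    case m: (Suc k)
    show ?thesis
    proof (cases "k \<le> N")
      \<comment> \<open>Here \<open>N - k\<close> is an exact subtraction of natural numbers. For
        \<open>k > N\<close> all brackets involved are \<open>0\<close>.\<close>
      case True
      have e: "(g\<^sup>2) powi (int N + 1 - int m) = g ^ (2 * (N - k))"
        using True m by (simp add: power_int_def power_mult nat_diff_distrib)
      have "g ^ (2 * N + 1) * g ^ (k\<^sup>2) = g ^ (m\<^sup>2) * g ^ (2 * (N - k))"
        unfolding power_add[symmetric] using True m
        by (intro arg_cong[of _ _ "power g"]) (simp add: power2_eq_square algebra_simps)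
      moreover have "coeff (\<Prod>k<Suc N. [:1, c * g ^ (2 * k + 1):]) m
        = c ^ m * g ^ (m\<^sup>2) * qbinom (g\<^sup>2) (int N) (int m) + c ^ m * (g ^ (2 * N + 1) * g ^ (k\<^sup>2)) * qbinom (g\<^sup>2) (int N) (int k)"
        unfolding eq using IH[of m] IH[of k] by (simp add: m mult_ac)
      ultimately show ?thesis unfolding pas e by (simp add: m algebra_simps)
    next
      case False
      thus ?thesis unfolding eq pas using IH[of m] IH[of k] by (simp add: m qbinom_neg)
    qed
  qed
qed

lemma prod_lessThan_triple:
  fixes f :: "nat \<Rightarrow> 'a :: comm_monoid_mult"
  shows "(\<Prod>k<3 * N. f k) = (\<Prod>k<N. f (3 * k) * f (3 * k + 1) * f (3 * k + 2))"
  by (induction N) (simp_all add: eval_nat_numeral mult_ac)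

text \<open>In the product over \<open>k < 3 * N\<close>, the factors with index
  \<open>3 * k\<close>, \<open>3 * k + 1\<close>, \<open>3 * k + 2\<close> carry
  \<open>G ^ (2 * k + 1)\<close> times \<open>1 / q\<close>, \<open>1\<close>, \<open>q\<close>.
  Each residue class is thus a product of the same kind with base \<open>G^2 = q^3\<close>, and
  comparing coefficients of degree \<open>m\<close> gives the convolution.\<close>

lemma qbinom_triple:
  fixes g :: complex
  assumes g: "g \<noteq> 0" "norm g < 1" and K: "N \<le> K"
  defines "q \<equiv> g\<^sup>2" and "G \<equiv> g ^ 3"
  shows "g ^ (m\<^sup>2) * qbinom q (int (3 * N)) (int m) =
    (\<Sum>a\<le>K. \<Sum>b\<le>K. \<Sum>c\<le>K. if a + b + c = m then
       G ^ (a\<^sup>2 + b\<^sup>2 + c\<^sup>2) * q powi (int c - int b)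
        * qbinom (q ^ 3) (int N) (int a) * qbinom (q ^ 3) (int N) (int b) * qbinom (q ^ 3) (int N) (int c) else 0)"
proof -
  define P where "P x = (\<Prod>k<N. [:1, x * G ^ (2 * k + 1):])" for x
  have G: "G \<noteq> 0" "norm G < 1" using g by (auto simp: G_def norm_power power_less_one_iff)
  have Gq: "G\<^sup>2 = q ^ 3" by (simp add: G_def q_def flip: power_mult)
  have q: "q \<noteq> 0" using g by (simp add: q_def)
  have cP: "coeff (P x) a = x ^ a * G ^ (a\<^sup>2) * qbinom (q ^ 3) (int N) (int a)" for x a
    unfolding P_def Gq[symmetric] by (rule qbinomial_theorem_coeff[OF G])
  have mP: "P x = (\<Sum>a\<le>K. monom (coeff (P x) a) a)" for x
    by (rule poly_as_sum_of_monoms'[symmetric], rule degree_le) (use K in \<open>auto simp: cP qbinom_neg\<close>)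
  have "(\<Prod>k<3 * N. [:1, 1 * g ^ (2 * k + 1):]) = P 1 * P (1 / q) * P q"
    unfolding prod_lessThan_triple P_def prod.distrib[symmetric]
  proof (intro prod.cong refl)
    fix k
    have Gk: "G ^ (2 * k + 1) = g ^ (3 * (2 * k + 1))"
      unfolding G_def by (rule power_mult[symmetric])
    also have "3 * (2 * k + 1) = 2 * (3 * k) + 1 + 2" by simp
    finally have "G ^ (2 * k + 1) = g ^ (2 * (3 * k) + 1) * q"
      by (simp only: q_def power_add)
    moreover have "x = (1 / q) * (x * q)" for x
      using q by simp
    ultimately have "g ^ (2 * (3 * k) + 1) = (1 / q) * G ^ (2 * k + 1)"
      by metis
    moreover have "g ^ (2 * (3 * k + 1) + 1) = G ^ (2 * k + 1)"
      unfolding Gk by (rule arg_cong[of _ _ "power g"]) simp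
    moreover have "2 * (3 * k + 2) + 1 = 2 + 3 * (2 * k + 1)" by simp
    hence "g ^ (2 * (3 * k + 2) + 1) = q * G ^ (2 * k + 1)"
      unfolding Gk q_def by (simp only: power_add)
    ultimately show "[:1, 1 * g ^ (2 * (3 * k) + 1):] * [:1, 1 * g ^ (2 * (3 * k + 1) + 1):]
         * [:1, 1 * g ^ (2 * (3 * k + 2) + 1):]
      = [:1, 1 * G ^ (2 * k + 1):] * [:1, 1 / q * G ^ (2 * k + 1):] * [:1, q * G ^ (2 * k + 1):]"
      by (simp only: mult_ac mult_1)
  qed
  hence "g ^ (m\<^sup>2) * qbinom q (int (3 * N)) (int m) = coeff (P 1 * P (1 / q) * P q) m"
    using qbinomial_theorem_coeff[OF g, of 1 "3 * N" m] by (simp add: q_def)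
  also have "P 1 * P (1 / q) * P q
      = (\<Sum>a\<le>K. \<Sum>b\<le>K. \<Sum>c\<le>K. monom (coeff (P 1) a * coeff (P (1 / q)) b * coeff (P q) c) (a + b + c))"
    unfolding mult.assoc add.assoc
    by (simp only: mult_monom[symmetric] sum_distrib_left[symmetric] sum_distrib_right[symmetric] mP[symmetric])
  also have "coeff \<dots> m = (\<Sum>a\<le>K. \<Sum>b\<le>K. \<Sum>c\<le>K. if a + b + c = m then coeff (P 1) a * coeff (P (1 / q)) b * coeff (P q) c else 0)"
    by (simp add: coeff_sum)
  also have "\<dots> = (\<Sum>a\<le>K. \<Sum>b\<le>K. \<Sum>c\<le>K. if a + b + c = m then
       G ^ (a\<^sup>2 + b\<^sup>2 + c\<^sup>2) * q powi (int c - int b)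
        * qbinom (q ^ 3) (int N) (int a) * qbinom (q ^ 3) (int N) (int b) * qbinom (q ^ 3) (int N) (int c) else 0)"
    using q by (intro sum.cong refl if_cong) (simp add: cP power_add power_int_diff power_divide)
  finally show ?thesis .
qed

section \<open>Evaluation of the sum over \<open>m\<close> for fixed \<open>i\<close>\<close>

lemma sum_atMost_int: "(\<Sum>i\<le>n. f (int i)) = (\<Sum>i\<in>{0..int n}. f i)"
  by (rule sum.reindex_bij_witness[of _ nat int]) auto

lemma sum_shift_int:
  fixes r L :: int
  assumes "r \<ge> 0" "\<And>x. x < r \<Longrightarrow> f x = 0" "\<And>x. x > L \<Longrightarrow> f x = 0"
  shows "(\<Sum>x\<in>{0..L}. f (x + r)) = (\<Sum>x\<in>{0..L}. f x)"
proof -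
  have "(\<Sum>x\<in>{0..L}. f (x + r)) = (\<Sum>x\<in>{r..L+r}. f x)"
    by (rule sum.reindex_bij_witness[of _ "\<lambda>x. x - r" "\<lambda>x. x + r"]) auto
  also have "\<dots> = (\<Sum>x\<in>{0..L}. f x)"
    by (rule sum.mono_neutral_cong) (use assms in auto)
  finally show ?thesis .
qed

text \<open>This is the Saalschuetz sum with shifts \<open>0\<close>, \<open>N - k\<close>,
  \<open>N - l\<close>. It eliminates the index \<open>r\<close> that couples the two outer factors
  of the threefold convolution.\<close>

lemma sum_qbinom_convolution:
  fixes p :: complex and N k l L :: int
  assumes p: "p \<noteq> 0" "norm p < 1" and "N \<ge> 0" "k \<in> {0..L}"
  shows "(\<Sum>r\<in>{0..L}. p powi ((k - r) * (l - r)) * qbinom p (2 * N + r) (2 * N)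
            * qbinom p N (k - r) * qbinom p N (l - r)) = qbinom p (N + l) k * qbinom p (N + k) l"
proof -
  have "(\<Sum>r\<in>{0..L}. p powi ((k - r) * (l - r)) * qbinom p (2 * N + r) (2 * N)
            * qbinom p N (k - r) * qbinom p N (l - r))
      = (qfac p N * qfac p N * rqfac p (2 * N)) *
        (\<Sum>r\<in>{0..L}. p powi ((k - r) * (l - r)) * qfac p (0 + (N - k) + (N - l) + k + l + r)
            * rqfac p (0 + r) * rqfac p (N - k + r) * rqfac p (N - l + r) * rqfac p (k - r) * rqfac p (l - r))"
    unfolding sum_distrib_left qbinom_eq by (intro sum.cong refl) (simp add: algebra_simps)
  also have "\<dots> = (qfac p N * rqfac p N) * (qfac p N * rqfac p N) * (qfac p (2 * N) * rqfac p (2 * N))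
      * (qfac p (N + l) * qfac p (N + k) * rqfac p k * rqfac p (N - l + k) * rqfac p l * rqfac p (N - k + l))"
    by (subst saalschuetz[OF p]) (use assms in \<open>auto simp: algebra_simps\<close>)
  also have "\<dots> = qbinom p (N + l) k * qbinom p (N + k) l"
    using assms by (simp add: qfac_mult_rqfac qbinom_eq algebra_simps)
  finally show ?thesis .
qed

text \<open>Integer indices avoid truncated subtraction when \<open>b\<close> and \<open>c\<close>
  are later written as \<open>k - r\<close> and \<open>l - r\<close>.\<close>

lemma qbinom_triple_int:
  fixes g :: complex and m N L :: int
  assumes g: "g \<noteq> 0" "norm g < 1" and "m \<ge> 0" "0 \<le> N" "N \<le> L"
  defines "q \<equiv> g\<^sup>2" and "G \<equiv> g ^ 3"
  shows "g powi m\<^sup>2 * qbinom q (3 * N) m =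
    (\<Sum>a\<in>{0..L}. \<Sum>b\<in>{0..L}. \<Sum>c\<in>{0..L}. if a + b + c = m then
       G powi (a\<^sup>2 + b\<^sup>2 + c\<^sup>2) * q powi (c - b)
        * qbinom (q ^ 3) N a * qbinom (q ^ 3) N b * qbinom (q ^ 3) N c else 0)"
proof -
  define Z where "Z a b c = (if a + b + c = m then G powi (a\<^sup>2 + b\<^sup>2 + c\<^sup>2) * q powi (c - b)
        * qbinom (q ^ 3) N a * qbinom (q ^ 3) N b * qbinom (q ^ 3) N c else 0)" for a b c
  obtain m' N' K where [simp]: "m = int m'" "N = int N'" "L = int K"
    using assms by (metis nat_0_le order.trans)
  have Z: "Z (int a) (int b) (int c) = (if a + b + c = m' then
       G ^ (a\<^sup>2 + b\<^sup>2 + c\<^sup>2) * q powi (int c - int b) * qbinom (q ^ 3) (int N') (int a)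
       * qbinom (q ^ 3) (int N') (int b) * qbinom (q ^ 3) (int N') (int c) else 0)" for a b c
  proof -
    have "G powi ((int a)\<^sup>2 + (int b)\<^sup>2 + (int c)\<^sup>2) = G powi (int (a\<^sup>2 + b\<^sup>2 + c\<^sup>2))" by simp
    also have "\<dots> = G ^ (a\<^sup>2 + b\<^sup>2 + c\<^sup>2)" by (rule power_int_of_nat)
    moreover have "int a + int b + int c = m \<longleftrightarrow> a + b + c = m'" by simp linarith
    ultimately show ?thesis by (simp add: Z_def)
  qed
  have "g powi m\<^sup>2 = g ^ (m'\<^sup>2)" by (simp flip: power_int_of_nat)
  hence "g powi m\<^sup>2 * qbinom q (3 * N) m = (\<Sum>a\<le>K. \<Sum>b\<le>K. \<Sum>c\<le>K. Z (int a) (int b) (int c))"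
    unfolding Z q_def G_def using qbinom_triple[OF g, of N' K m'] assms(5) by simp
  also have "\<dots> = (\<Sum>a\<in>{0..L}. \<Sum>b\<in>{0..L}. \<Sum>c\<in>{0..L}. Z a b c)"
    unfolding sum_atMost_int[of "\<lambda>c. Z x y c" for x y]
      sum_atMost_int[of "\<lambda>b. \<Sum>c\<in>A. Z x b c" for x A]
      sum_atMost_int[of "\<lambda>a. \<Sum>b\<in>B. \<Sum>c\<in>A. Z a b c" for A B] by simp
  finally show ?thesis unfolding Z_def .
qed

text \<open>The parity condition is encoded as \<open>m + 2 * r = i\<close>. After the threefold
  expansion, \<open>k = b + r\<close> and \<open>l = c + r\<close> turn
  \<open>a + b + c + 2 * r = i\<close> into the condition \<open>a + k + l = i\<close>, which is
  free of \<open>r\<close>, and the remaining \<open>r\<close>-sum is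
  \<open>sum_qbinom_convolution\<close>.\<close>

lemma inner_sum:
  fixes g :: complex and i L :: int
  assumes g: "g \<noteq> 0" "norm g < 1" and i: "i \<in> {0..L}"
  defines "q \<equiv> g\<^sup>2" and "G \<equiv> g ^ 3" and "N \<equiv> L - i"
  shows "(\<Sum>m\<in>{0..3*L}. if even (i + m) then g powi m\<^sup>2 * qbinom q (3 * N) m
            * qbinom (q ^ 3) (2 * N + (i - m) div 2) (2 * N) else 0)
       = (\<Sum>a\<in>{0..L}. \<Sum>k\<in>{0..L}. \<Sum>l\<in>{0..L}. if a + k + l = i then
            G powi (a\<^sup>2 + (l - k)\<^sup>2) * q powi (l - k) * qbinom (q ^ 3) N a
            * qbinom (q ^ 3) (N + l) k * qbinom (q ^ 3) (N + k) l else 0)"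
    (is "(\<Sum>m\<in>?A. ?f m) = _")
proof -
  define I where "I = {0..L}"
  have N: "0 \<le> N" "N \<le> L" using i by (auto simp: N_def)
  have q: "q \<noteq> 0" "norm q < 1" using g by (auto simp: q_def norm_power power_less_one_iff)
  have p: "q ^ 3 \<noteq> 0" "norm (q ^ 3) < 1" using q by (auto simp: norm_power power_less_one_iff)
  have G: "G \<noteq> 0" using g by (simp add: G_def)
  have Gp: "G powi (2 * x) = (q ^ 3) powi x" for x
  proof -
    have "G powi 2 = q ^ 3" by (simp add: G_def q_def power_int_def flip: power_mult)
    thus ?thesis by (simp add: power_int_mult)
  qed
  define W where "W r = qbinom (q ^ 3) (2 * N + r) (2 * N)" for r
  define Y where "Y a b c = G powi (a\<^sup>2 + b\<^sup>2 + c\<^sup>2) * q powi (c - b)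
        * qbinom (q ^ 3) N a * qbinom (q ^ 3) N b * qbinom (q ^ 3) N c" for a b c
  define F where "F r a k l = (if a + k + l = i then Y a (k - r) (l - r) * W r else 0)" for r a k l
  have f: "?f m = (\<Sum>r\<in>I. \<Sum>a\<in>I. \<Sum>b\<in>I. \<Sum>c\<in>I.
              if m = a + b + c then if a + b + c + 2 * r = i then Y a b c * W r else 0 else 0)"
    if m: "m \<in> ?A" for m
  proof -
    have "?f m = (\<Sum>r\<in>I. if m + 2 * r = i then g powi m\<^sup>2 * qbinom q (3 * N) m * W r else 0)"
    proof (cases "even (i + m)")
      case False
      hence "m + 2 * r \<noteq> i" for r by auto
      thus ?thesis using False by simp
    next
      case True
      hence "even (i - m)" by simp
      then obtain s where s: "i - m = 2 * s" by blast
      hence "m + 2 * r = i \<longleftrightarrow> r = s" for r by auto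
      hence "(\<Sum>r\<in>I. if m + 2 * r = i then g powi m\<^sup>2 * qbinom q (3 * N) m * W r else 0)
          = (if s \<in> I then g powi m\<^sup>2 * qbinom q (3 * N) m * W s else 0)"
        by (simp add: I_def sum.delta)
      \<comment> \<open>If \<open>s\<close> is not in \<open>I\<close>, then \<open>s < 0\<close>,
        since \<open>2 * s = i - m \<le> L\<close>. The upper entry \<open>2 * N + s\<close> is then
        below the lower entry \<open>2 * N\<close>, so the bracket is \<open>0\<close>.\<close>
      also have "\<dots> = ?f m"
        using True s m i by (auto simp: W_def I_def qbinom_neg)
      finally show ?thesis ..
    qed
    also have "\<dots> = (\<Sum>r\<in>I. if m + 2 * r = i then
        (\<Sum>a\<in>I. \<Sum>b\<in>I. \<Sum>c\<in>I. if a + b + c = m then Y a b c else 0) * W r else 0)"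
    proof -
      have "g powi m\<^sup>2 * qbinom q (3 * N) m = (\<Sum>a\<in>I. \<Sum>b\<in>I. \<Sum>c\<in>I. if a + b + c = m then Y a b c else 0)"
        unfolding Y_def I_def q_def G_def
        by (rule qbinom_triple_int[OF g]) (use m N in auto)
      thus ?thesis by (simp only:)
    qed
    also have "\<dots> = (\<Sum>r\<in>I. \<Sum>a\<in>I. \<Sum>b\<in>I. \<Sum>c\<in>I.
              if m = a + b + c then if a + b + c + 2 * r = i then Y a b c * W r else 0 else 0)"
    proof (rule sum.cong[OF refl])
      fix r
      show "(if m + 2 * r = i then
          (\<Sum>a\<in>I. \<Sum>b\<in>I. \<Sum>c\<in>I. if a + b + c = m then Y a b c else 0) * W r else 0)
        = (\<Sum>a\<in>I. \<Sum>b\<in>I. \<Sum>c\<in>I.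
              if m = a + b + c then if a + b + c + 2 * r = i then Y a b c * W r else 0 else 0)"
        unfolding sum_distrib_right by (cases "m + 2 * r = i") (auto intro!: sum.cong sum.neutral)
    qed
    finally show ?thesis .
  qed
  have "(\<Sum>m\<in>?A. ?f m) = (\<Sum>m\<in>?A. \<Sum>r\<in>I. \<Sum>a\<in>I. \<Sum>b\<in>I. \<Sum>c\<in>I.
              if m = a + b + c then if a + b + c + 2 * r = i then Y a b c * W r else 0 else 0)"
    by (rule sum.cong[OF refl f])
  also have "\<dots> = (\<Sum>r\<in>I. \<Sum>a\<in>I. \<Sum>b\<in>I. \<Sum>c\<in>I. \<Sum>m\<in>?A.
              if m = a + b + c then if a + b + c + 2 * r = i then Y a b c * W r else 0 else 0)"
    by (subst sum.swap, rule sum.cong[OF refl], subst sum.swap, rule sum.cong[OF refl],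
        subst sum.swap, rule sum.cong[OF refl], rule sum.swap)
  \<comment> \<open>The bound \<open>3 * L\<close> on \<open>m\<close> ensures that
    \<open>a + b + c\<close> always lies in the range of summation.\<close>
  also have "\<dots> = (\<Sum>r\<in>I. \<Sum>a\<in>I. \<Sum>b\<in>I. \<Sum>c\<in>I. F r a (b + r) (c + r))"
    by (intro sum.cong refl) (auto simp: F_def sum.delta I_def)
  also have "\<dots> = (\<Sum>r\<in>I. \<Sum>a\<in>I. \<Sum>k\<in>I. \<Sum>l\<in>I. F r a k l)"
  proof (rule sum.cong[OF refl], rule sum.cong[OF refl])
    fix r a assume ra: "r \<in> I" "a \<in> I"
    have F0: "F r a k l = 0" if "k < r \<or> l < r" for k l
      using that by (auto simp: F_def Y_def qbinom_neg)
    \<comment> \<open>The condition \<open>a + k + l = i\<close> with \<open>i \<le> L\<close>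
      excludes indices above \<open>L\<close>.\<close>
    have F1: "F r a k l = 0" if "k \<ge> 0" "l > L \<or> k > L" "l \<ge> 0" for k l
      using that i ra by (auto simp: F_def I_def)
    have "(\<Sum>b\<in>I. \<Sum>c\<in>I. F r a (b + r) (c + r)) = (\<Sum>b\<in>I. \<Sum>l\<in>I. F r a (b + r) l)"
      unfolding I_def
      by (intro sum.cong refl sum_shift_int) (use ra F0 F1 in \<open>auto simp: I_def\<close>)
    also have "\<dots> = (\<Sum>k\<in>I. \<Sum>l\<in>I. F r a k l)"
      unfolding I_def
      by (intro sum_shift_int sum.neutral) (use ra F0 F1 in \<open>auto simp: I_def intro!: sum.neutral\<close>)
    finally show "(\<Sum>b\<in>I. \<Sum>c\<in>I. F r a (b + r) (c + r)) = (\<Sum>k\<in>I. \<Sum>l\<in>I. F r a k l)" .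
  qed
  also have "\<dots> = (\<Sum>a\<in>I. \<Sum>k\<in>I. \<Sum>l\<in>I. \<Sum>r\<in>I. F r a k l)"
    by (subst sum.swap, rule sum.cong[OF refl], subst sum.swap, rule sum.cong[OF refl], rule sum.swap)
  also have "\<dots> = (\<Sum>a\<in>I. \<Sum>k\<in>I. \<Sum>l\<in>I. if a + k + l = i then
            G powi (a\<^sup>2 + (l - k)\<^sup>2) * q powi (l - k) * qbinom (q ^ 3) N a
            * qbinom (q ^ 3) (N + l) k * qbinom (q ^ 3) (N + k) l else 0)"
  proof (rule sum.cong[OF refl], rule sum.cong[OF refl], rule sum.cong[OF refl])
    fix a k l assume akl: "a \<in> I" "k \<in> I" "l \<in> I"
    have "(\<Sum>r\<in>I. Y a (k - r) (l - r) * W r) = G powi (a\<^sup>2 + (l - k)\<^sup>2) * q powi (l - k) * qbinom (q ^ 3) N a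
        * (\<Sum>r\<in>I. (q ^ 3) powi ((k - r) * (l - r)) * W r * qbinom (q ^ 3) N (k - r) * qbinom (q ^ 3) N (l - r))"
      unfolding sum_distrib_left
    proof (rule sum.cong[OF refl])
      fix r
      \<comment> \<open>This rests on
        \<open>(k - r)^2 + (l - r)^2 = (l - k)^2 + 2 * (k - r) * (l - r)\<close>.\<close>
      have "G powi (a\<^sup>2 + (k - r)\<^sup>2 + (l - r)\<^sup>2) = G powi (a\<^sup>2 + (l - k)\<^sup>2) * (q ^ 3) powi ((k - r) * (l - r))"
        unfolding Gp[symmetric] power_int_add[of G, OF disjI1[OF G], symmetric]
        by (simp add: power2_eq_square algebra_simps)
      thus "Y a (k - r) (l - r) * W r = G powi (a\<^sup>2 + (l - k)\<^sup>2) * q powi (l - k) * qbinom (q ^ 3) N a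
        * ((q ^ 3) powi ((k - r) * (l - r)) * W r * qbinom (q ^ 3) N (k - r) * qbinom (q ^ 3) N (l - r))"
        by (simp add: Y_def)
    qed
    also have "\<dots> = G powi (a\<^sup>2 + (l - k)\<^sup>2) * q powi (l - k) * qbinom (q ^ 3) N a
            * qbinom (q ^ 3) (N + l) k * qbinom (q ^ 3) (N + k) l"
      using sum_qbinom_convolution[OF p N(1), of k L l] akl by (simp add: W_def I_def)
    finally show "(\<Sum>r\<in>I. F r a k l) = (if a + k + l = i then
            G powi (a\<^sup>2 + (l - k)\<^sup>2) * q powi (l - k) * qbinom (q ^ 3) N a
            * qbinom (q ^ 3) (N + l) k * qbinom (q ^ 3) (N + k) l else 0)"
      by (simp add: F_def)
  qed
  finally show ?thesis unfolding I_def .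
qed

section \<open>The identity\<close>

lemma qtrinom_eq_sum:
  fixes K :: int
  assumes "\<And>n. n > K \<Longrightarrow> qbinom q (M + L - a - 2 * n) M * qbinom q (M - a + b) n * qbinom q (M + a - b) (n + a) = 0"
  shows "qtrinom L M a b q = (\<Sum>n\<in>{0..K}. q powi (n * (n + a)) * qbinom q (M + L - a - 2 * n) M
           * qbinom q (M - a + b) n * qbinom q (M + a - b) (n + a))"
    (is "_ = sum ?f _")
proof -
  have zero: "?f n = 0" if "n > K" for n
    using assms[OF that] by auto
  have "qtrinom L M a b q = (\<Sum>\<^sub>\<infinity>n. ?f (int n))" by (simp add: qtrinom_def)
  also have "\<dots> = infsum ?f {0..}"
    by (rule infsum_reindex_bij_witness[of _ nat int]) auto
  also have "\<dots> = infsum ?f {0..K}"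
  proof (rule infsum_cong_neutral)
    show "?f n = 0" if "n \<in> {0..} - {0..K}" for n
      by (rule zero) (use that in auto)
  qed auto
  finally show ?thesis by simp
qed

lemma qtrinom_nonneg:
  assumes "L \<ge> 0" "M \<ge> 0" "j \<ge> 0"
  shows "qtrinom L M (2 * j) j p = (\<Sum>n\<in>{0..L}. p powi (n * (n + 2 * j)) * qbinom p (M + L - 2 * j - 2 * n) M
            * qbinom p (M - j) n * qbinom p (M + j) (n + 2 * j))"
  using assms by (subst qtrinom_eq_sum[of L]) (auto simp: qbinom_neg add.commute[of j M] intro!: sum.cong)

text \<open>Shifting \<open>n\<close> by \<open>2 * j\<close> interchanges the last two brackets.
  The terms with \<open>n < 2 * j\<close> are lost without effect, since the lower entry
  \<open>n - 2 * j\<close> is negative.\<close>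

lemma qtrinom_uminus:
  assumes "L \<ge> 0" "M \<ge> 0" "j \<ge> 0"
  shows "qtrinom L M (2 * (-j)) (-j) p = qtrinom L M (2 * j) j p"
proof -
  define f where "f n = p powi (n * (n - 2 * j)) * qbinom p (M + L + 2 * j - 2 * n) M
            * qbinom p (M + j) n * qbinom p (M - j) (n - 2 * j)" for n
  have "qtrinom L M (2 * (-j)) (-j) p = sum f {0..L + 2 * j}"
    using assms by (subst qtrinom_eq_sum[of "L + 2 * j"]) (auto simp: f_def qbinom_neg add.commute[of j M] intro!: sum.cong)
  also have "\<dots> = sum f {2 * j..L + 2 * j}"
    using assms by (intro sum.mono_neutral_right) (auto simp: f_def qbinom_neg)
  also have "\<dots> = (\<Sum>n\<in>{0..L}. f (n + 2 * j))"
    by (rule sum.reindex_bij_witness[of _ "\<lambda>n. n + 2 * j" "\<lambda>n. n - 2 * j"]) auto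
  also have "\<dots> = qtrinom L M (2 * j) j p"
    unfolding qtrinom_nonneg[OF assms] f_def by (intro sum.cong refl) (simp add: algebra_simps)
  finally show ?thesis .
qed

text \<open>The left-hand side collects the terms with \<open>l - k = j\<close>, apart from the
  power of \<open>q\<close>. A negative \<open>j\<close> is reduced to \<open>-j\<close> by a shift
  of \<open>k\<close>, which interchanges the last two brackets, together with
  \<open>qtrinom_uminus\<close>.\<close>

lemma trinomial_transformation:
  fixes G :: complex and L M j :: int
  assumes G: "G \<noteq> 0" "norm G < 1" and ge: "L \<ge> 0" "M \<ge> 0"
  shows "(\<Sum>a\<in>{0..L}. \<Sum>k\<in>{0..L}.
             G powi ((a + 2 * k + j)\<^sup>2 + a\<^sup>2 + j\<^sup>2) * qbinom (G\<^sup>2) (L + M - (a + 2 * k + j)) L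
            * qbinom (G\<^sup>2) (L - (a + 2 * k + j)) a
            * qbinom (G\<^sup>2) (L - a - k) k * qbinom (G\<^sup>2) (L - a - k - j) (k + j))
       = (G\<^sup>2) powi j\<^sup>2 * qtrinom L M (2 * j) j (G\<^sup>2)"
    (is "?S j = _")
proof -
  define p where "p = G\<^sup>2"
  have p: "p \<noteq> 0" "norm p < 1" using G by (auto simp: p_def norm_power power_less_one_iff)
  have Gp: "G powi (2 * x) = p powi x" for x
    by (simp add: power_int_mult p_def)
  have nonneg: "?S j = p powi j\<^sup>2 * qtrinom L M (2 * j) j p" if j: "j \<ge> 0" for j
  proof -
    \<comment> \<open>With \<open>T = a + k\<close> the exponent of \<open>G\<close> becomes even,
      so that only powers of \<open>p = G^2\<close> remain.\<close>
    define t where "t T k = G powi ((T + k + j)\<^sup>2 + (T - k)\<^sup>2 + j\<^sup>2) * qbinom p (L + M - (T + k + j)) L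
            * qbinom p (L - (T + k + j)) (T - k) * qbinom p (L - T) k * qbinom p (L - T - j) (k + j)" for T k
    have "?S j = (\<Sum>k\<in>{0..L}. \<Sum>a\<in>{0..L}. t (a + k) k)"
      by (subst sum.swap) (simp add: t_def p_def algebra_simps)
    also have "\<dots> = (\<Sum>k\<in>{0..L}. \<Sum>T\<in>{0..L}. t T k)"
      by (intro sum.cong refl sum_shift_int) (use j in \<open>auto simp: t_def qbinom_neg\<close>)
    also have "\<dots> = (\<Sum>T\<in>{0..L}. \<Sum>k\<in>{0..L}. t T k)" by (rule sum.swap)
    also have "\<dots> = p powi j\<^sup>2 * (\<Sum>T\<in>{0..L}. \<Sum>k\<in>{0..L}. p powi (T\<^sup>2 + k\<^sup>2 + T * j + k * j)
            * qbinom p (L + M - (T + k + j)) L * qbinom p (L - (T + k + j)) (T - k)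
            * qbinom p (L - T) k * qbinom p (L - T - j) (k + j))"
      unfolding sum_distrib_left
    proof (intro sum.cong refl)
      fix T k
      have "(T + k + j)\<^sup>2 + (T - k)\<^sup>2 + j\<^sup>2 = 2 * (j\<^sup>2 + (T\<^sup>2 + k\<^sup>2 + T * j + k * j))"
        by (simp add: power2_eq_square algebra_simps)
      hence "G powi ((T + k + j)\<^sup>2 + (T - k)\<^sup>2 + j\<^sup>2) = p powi j\<^sup>2 * p powi (T\<^sup>2 + k\<^sup>2 + T * j + k * j)"
        by (simp only: Gp power_int_add[OF disjI1[OF p(1)]])
      thus "t T k = p powi j\<^sup>2 * (p powi (T\<^sup>2 + k\<^sup>2 + T * j + k * j)
            * qbinom p (L + M - (T + k + j)) L * qbinom p (L - (T + k + j)) (T - k)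
            * qbinom p (L - T) k * qbinom p (L - T - j) (k + j))"
        by (simp add: t_def mult_ac)
    qed
    also have "\<dots> = p powi j\<^sup>2 * qtrinom L M (2 * j) j p"
      unfolding trinomial_transformation_nonneg[OF p ge j] qtrinom_nonneg[OF ge j] ..
    finally show ?thesis .
  qed
  show ?thesis
  proof (cases "j \<ge> 0")
    case True
    thus ?thesis using nonneg[of j] by (simp add: p_def)
  next
    case False
    define i where "i = -j"
    have i: "i \<ge> 0" "j = -i" using False by (auto simp: i_def)
    have "?S j = ?S i"
    proof (rule sum.cong[OF refl])
      fix a assume a: "a \<in> {0..L}"
      define f where "f l = G powi ((a + 2 * l - i)\<^sup>2 + a\<^sup>2 + i\<^sup>2) * qbinom (G\<^sup>2) (L + M - (a + 2 * l - i)) L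
            * qbinom (G\<^sup>2) (L - (a + 2 * l - i)) a
            * qbinom (G\<^sup>2) (L - a - l) l * qbinom (G\<^sup>2) (L - a - l + i) (l - i)" for l
      have "(\<Sum>l\<in>{0..L}. f l) = (\<Sum>k\<in>{0..L}. f (k + i))"
        by (rule sum_shift_int[symmetric]) (use i a in \<open>auto simp: f_def qbinom_neg\<close>)
      thus "(\<Sum>k\<in>{0..L}. G powi ((a + 2 * k + j)\<^sup>2 + a\<^sup>2 + j\<^sup>2) * qbinom (G\<^sup>2) (L + M - (a + 2 * k + j)) L
            * qbinom (G\<^sup>2) (L - (a + 2 * k + j)) a
            * qbinom (G\<^sup>2) (L - a - k) k * qbinom (G\<^sup>2) (L - a - k - j) (k + j))
        = (\<Sum>k\<in>{0..L}. G powi ((a + 2 * k + i)\<^sup>2 + a\<^sup>2 + i\<^sup>2) * qbinom (G\<^sup>2) (L + M - (a + 2 * k + i)) L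
            * qbinom (G\<^sup>2) (L - (a + 2 * k + i)) a
            * qbinom (G\<^sup>2) (L - a - k) k * qbinom (G\<^sup>2) (L - a - k - i) (k + i))"
        by (simp add: f_def i algebra_simps)
    qed
    also have "\<dots> = p powi j\<^sup>2 * qtrinom L M (2 * j) j p"
      using nonneg[OF i(1)] qtrinom_uminus[OF ge i(1), of p] by (simp add: i)
    finally show ?thesis by (simp add: p_def)
  qed
qed

text \<open>For \<open>j > L\<close> the upper entry \<open>M + L - 2 * j - 2 * n\<close> is below
  \<open>M\<close>; negative \<open>j\<close> follow by symmetry. A bound by \<open>L\<close> is
  needed because the left-hand side produces exactly the values of \<open>j\<close> from
  \<open>-L\<close> to \<open>L\<close>.\<close>

lemma qtrinom_eq_0_of_gt:
  assumes "L \<ge> 0" "M \<ge> 0" "\<bar>j\<bar> > L"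
  shows "qtrinom L M (2 * j) j p = 0"
proof -
  have 0: "qtrinom L M (2 * i) i p = 0" if "i > L" for i
    unfolding qtrinom_nonneg[OF assms(1,2) order.trans[OF assms(1) less_imp_le[OF that]]]
    using that by (intro sum.neutral) (auto simp: qbinom_neg)
  show ?thesis
  proof (cases "j \<ge> 0")
    case True
    thus ?thesis using 0 assms by simp
  next
    case False
    thus ?thesis using qtrinom_uminus[OF assms(1,2), of "-j" p] 0[of "-j"] assms by simp
  qed
qed

lemma qbinom_0: "0 \<le> m \<Longrightarrow> m \<le> N \<Longrightarrow> qbinom 0 N m = 1"
  by (simp add: qbinom_def qpoch_def)

theorem theorem6p1:
  fixes q :: complex and L M :: nat
  assumes "norm q < 1"
  shows "(\<Sum>\<^sub>\<infinity>(i :: nat, m :: nat) \<in> {(i, m). even (i + m)}.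
            q ^ ((m^2 + 3 * i^2) div 2)
            * qbinom (q^3) (int L + int M - int i) (int L)
            * qbinom q (3 * (int L - int i)) (int m)
            * qbinom (q^3) (2 * (int L - int i) + (int i - int m) div 2) (2 * (int L - int i)))
       = (\<Sum>\<^sub>\<infinity>j :: int. q powi (3 * j^2 + j) * qtrinom (int L) (int M) (2 * j) j (q^3))"
    (is "infsum ?F ?S = infsum ?R UNIV")
proof (cases "q = 0")
  case True
  \<comment> \<open>The case \<open>q = 0\<close> is separate because negative powers of
    \<open>q\<close> occur below. Only the constant term survives on either side.\<close>
  have "infsum ?F ?S = infsum (\<lambda>_. 1) {(0 :: nat, 0 :: nat)}"
  proof (rule infsum_cong_neutral)
    fix x assume x: "x \<in> ?S - {(0, 0)}"
    obtain i m where im: "x = (i, m)" by force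
    \<comment> \<open>The pair \<open>(0, 1)\<close>, whose halved exponent would also be
      \<open>0\<close>, is excluded by parity.\<close>
    have "i \<noteq> 0 \<or> m \<ge> 2"
      using x by (cases m; cases "m - 1") (auto simp: im odd_pos)
    hence "(m\<^sup>2 + 3 * i\<^sup>2) div 2 > 0"
    proof
      assume "m \<ge> 2"
      hence "m\<^sup>2 \<ge> 2\<^sup>2" by (rule power_mono) simp
      thus ?thesis by simp
    next
      assume "i \<noteq> 0"
      hence "i\<^sup>2 \<ge> 1" by simp
      thus ?thesis by linarith
    qed
    thus "?F x = 0" using True by (simp add: im)
  qed (use True in \<open>auto simp: qbinom_0\<close>)
  also have "\<dots> = infsum (\<lambda>_. 1) {0 :: int}" by simp
  also have "\<dots> = infsum ?R UNIV"
  proof (rule infsum_cong_neutral)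
    fix j :: int assume "j \<in> UNIV - {0}"
    \<comment> \<open>The factor \<open>3 * j + 1\<close> has no integer root.\<close>
    hence "j * (3 * j + 1) \<noteq> 0" by auto
    hence "3 * j\<^sup>2 + j \<noteq> 0" by (simp add: power2_eq_square algebra_simps)
    thus "?R j = 0" using True by simp
  next
    fix j :: int assume "j \<in> {0} \<inter> UNIV"
    moreover have "qtrinom (int L) (int M) 0 0 0 = 1"
    proof -
      have "qtrinom (int L) (int M) 0 0 0 = infsum (\<lambda>_. 1) {0 :: nat}"
        unfolding qtrinom_def
        by (rule infsum_cong_neutral) (auto simp: qbinom_0)
      thus ?thesis by simp
    qed
    ultimately show "1 = ?R j" using True by simp
  qed auto
  finally show ?thesis .
next
  case False
  define g where "g = csqrt q"
  define G where "G = g ^ 3"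
  have gq: "g\<^sup>2 = q" by (simp add: g_def)
  have g: "g \<noteq> 0" "norm g < 1"
  proof -
    show "g \<noteq> 0" using False by (simp add: g_def)
    have "norm g ^ 2 < 1" using assms by (simp add: gq flip: norm_power)
    thus "norm g < 1" by (simp add: power_less_one_iff)
  qed
  have G: "G \<noteq> 0" "norm G < 1" using g by (auto simp: G_def norm_power power_less_one_iff)
  have G2: "G\<^sup>2 = q ^ 3" by (simp add: G_def flip: gq power_mult)
  define I where "I = {0..int L}"
  define A where "A = {0..3 * int L}"
  define B where "B = qbinom (q ^ 3)"
  define F where "F i m = (if even (i + m) then g powi m\<^sup>2 * qbinom q (3 * (int L - i)) m
            * B (2 * (int L - i) + (i - m) div 2) (2 * (int L - i)) else 0)" for i m :: int
  \<comment> \<open>The summand after \<open>inner_sum\<close>, with \<open>i = a + k + l\<close>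
    substituted; thus \<open>L - i + l\<close> has become \<open>L - a - k\<close>.\<close>
  define t where "t a k l = G powi ((a + k + l)\<^sup>2 + a\<^sup>2 + (l - k)\<^sup>2) * q powi (l - k)
     * B (int L + int M - (a + k + l)) L * B (int L - (a + k + l)) a
     * B (int L - a - k) k * B (int L - a - l) l" for a k l :: int
  have F: "?F (i, m) = B (int L + int M - int i) L * G powi (int i)\<^sup>2 * F (int i) (int m)"
    if "even (i + m)" for i m
  proof -
    have "even (m\<^sup>2 + 3 * i\<^sup>2)" using that by auto
    hence "q ^ ((m\<^sup>2 + 3 * i\<^sup>2) div 2) = g ^ (m\<^sup>2 + 3 * i\<^sup>2)"
      unfolding gq[symmetric] by (simp flip: power_mult)
    also have "\<dots> = g powi (int m)\<^sup>2 * G powi (int i)\<^sup>2"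
      by (simp add: power_add power_mult G_def flip: of_nat_power)
    finally show ?thesis using that by (simp add: F_def B_def)
  qed
  have "infsum ?F ?S = infsum (\<lambda>(i, m). B (int L + int M - int i) L * G powi (int i)\<^sup>2 * F (int i) (int m)) ({..L} \<times> {..3 * L})"
  proof (rule infsum_cong_neutral)
    fix x assume "x \<in> ?S - {..L} \<times> {..3 * L}"
    thus "?F x = 0" by (auto simp: qbinom_def split: if_splits)
  next
    fix x assume "x \<in> {..L} \<times> {..3 * L} - ?S"
    thus "(case x of (i, m) \<Rightarrow> B (int L + int M - int i) L * G powi (int i)\<^sup>2 * F (int i) (int m)) = 0"
      by (auto simp: F_def split: if_splits)
  next
    fix x assume "x \<in> ?S \<inter> {..L} \<times> {..3 * L}"
    thus "?F x = (case x of (i, m) \<Rightarrow> B (int L + int M - int i) L * G powi (int i)\<^sup>2 * F (int i) (int m))"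
      using F by auto
  qed
  also have "\<dots> = (\<Sum>i\<le>L. \<Sum>m\<le>3 * L. B (int L + int M - int i) L * G powi (int i)\<^sup>2 * F (int i) (int m))"
    by (simp add: sum.cartesian_product)
  also have "\<dots> = (\<Sum>i\<in>I. B (int L + int M - i) L * G powi i\<^sup>2 * (\<Sum>m\<in>A. F i m))"
    unfolding sum_distrib_left[symmetric] sum_atMost_int[of "F x" for x]
      sum_atMost_int[of "\<lambda>i. B (int L + int M - i) L * G powi i\<^sup>2 * sum (F i) X" for X]
    by (simp add: I_def A_def)
  also have "\<dots> = (\<Sum>i\<in>I. \<Sum>a\<in>I. \<Sum>k\<in>I. \<Sum>l\<in>I. if i = a + k + l then t a k l else 0)"
  proof (rule sum.cong[OF refl])
    fix i assume i: "i \<in> I"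
    have inner: "(\<Sum>m\<in>A. F i m) = (\<Sum>a\<in>I. \<Sum>k\<in>I. \<Sum>l\<in>I. if a + k + l = i then
            G powi (a\<^sup>2 + (l - k)\<^sup>2) * q powi (l - k) * B (int L - i) a
            * B (int L - i + l) k * B (int L - i + k) l else 0)"
      using inner_sum[OF g, of i "int L"] i unfolding gq G_def[symmetric] I_def A_def F_def B_def by simp
    show "B (int L + int M - i) L * G powi i\<^sup>2 * (\<Sum>m\<in>A. F i m)
        = (\<Sum>a\<in>I. \<Sum>k\<in>I. \<Sum>l\<in>I. if i = a + k + l then t a k l else 0)"
      unfolding inner sum_distrib_left
    proof (intro sum.cong refl)
      fix a k l
      have e: "int L - (a + k + l) + l = int L - a - k" "int L - (a + k + l) + k = int L - a - l"
        by simp_all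
      show "B (int L + int M - i) L * G powi i\<^sup>2 * (if a + k + l = i then
            G powi (a\<^sup>2 + (l - k)\<^sup>2) * q powi (l - k) * B (int L - i) a
            * B (int L - i + l) k * B (int L - i + k) l else 0)
          = (if i = a + k + l then t a k l else 0)"
        by (cases "i = a + k + l")
           (simp_all only: e t_def power_int_add[OF disjI1[OF G(1)]] mult_ac if_True, auto)
    qed
  qed
  also have "\<dots> = (\<Sum>a\<in>I. \<Sum>k\<in>I. \<Sum>l\<in>I. \<Sum>i\<in>I. if i = a + k + l then t a k l else 0)"
    by (subst sum.swap, rule sum.cong[OF refl], subst sum.swap, rule sum.cong[OF refl], rule sum.swap)
  \<comment> \<open>For \<open>a + k + l > L\<close> no \<open>i\<close> matches, but then the
    bracket with upper entry \<open>L - (a + k + l)\<close> is \<open>0\<close>.\<close>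
  also have "\<dots> = (\<Sum>a\<in>I. \<Sum>k\<in>I. \<Sum>l\<in>I. t a k l)"
    by (intro sum.cong refl) (auto simp: I_def t_def B_def qbinom_neg)
  also have "\<dots> = (\<Sum>a\<in>I. \<Sum>k\<in>I. \<Sum>j\<in>{-int L..int L}. t a k (k + j))"
  proof (rule sum.cong[OF refl], rule sum.cong[OF refl])
    fix a k assume ak: "a \<in> I" "k \<in> I"
    have "(\<Sum>j\<in>{-int L..int L}. t a k (k + j)) = (\<Sum>l\<in>{k-int L..k+int L}. t a k l)"
      by (rule sum.reindex_bij_witness[of _ "\<lambda>l. l - k" "\<lambda>j. k + j"]) auto
    \<comment> \<open>The shifted interval contains \<open>I\<close> because
      \<open>0 \<le> k \<le> L\<close>, and for \<open>l\<close> outside \<open>I\<close> the last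
      bracket of \<open>t\<close> vanishes.\<close>
    also have "\<dots> = (\<Sum>l\<in>I. t a k l)"
      by (rule sum.mono_neutral_right) (use ak in \<open>auto simp: I_def t_def B_def qbinom_neg\<close>)
    finally show "(\<Sum>l\<in>I. t a k l) = (\<Sum>j\<in>{-int L..int L}. t a k (k + j))" ..
  qed
  also have "\<dots> = (\<Sum>j\<in>{-int L..int L}. \<Sum>a\<in>I. \<Sum>k\<in>I. t a k (k + j))"
  proof -
    have "(\<Sum>a\<in>I. \<Sum>k\<in>I. \<Sum>j\<in>{-int L..int L}. t a k (k + j)) = (\<Sum>a\<in>I. \<Sum>j\<in>{-int L..int L}. \<Sum>k\<in>I. t a k (k + j))"
      by (rule sum.cong[OF refl], rule sum.swap)
    also have "\<dots> = (\<Sum>j\<in>{-int L..int L}. \<Sum>a\<in>I. \<Sum>k\<in>I. t a k (k + j))" by (rule sum.swap)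
    finally show ?thesis .
  qed
  also have "\<dots> = (\<Sum>j\<in>{-int L..int L}. ?R j)"
  proof (rule sum.cong[OF refl])
    fix j :: int
    have "t a k (k + j) = q powi j * (G powi ((a + 2 * k + j)\<^sup>2 + a\<^sup>2 + j\<^sup>2) * B (int L + int M - (a + 2 * k + j)) L
            * B (int L - (a + 2 * k + j)) a * B (int L - a - k) k * B (int L - a - k - j) (k + j))" for a k
      by (simp add: t_def algebra_simps)
    hence "(\<Sum>a\<in>I. \<Sum>k\<in>I. t a k (k + j)) = q powi j * ((q ^ 3) powi j\<^sup>2 * qtrinom L M (2 * j) j (q ^ 3))"
      using trinomial_transformation[OF G, of "int L" "int M" j]
      unfolding G2 I_def B_def by (simp flip: sum_distrib_left)
    \<comment> \<open>The factors \<open>q powi j\<close> and \<open>(q^3) powi j^2\<close> combine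
      to the exponent \<open>3 * j^2 + j\<close>.\<close>
    also have "\<dots> = ?R j"
      using False by (simp add: power_int_add power_int_mult)
    finally show "(\<Sum>a\<in>I. \<Sum>k\<in>I. t a k (k + j)) = ?R j" .
  qed
  also have "\<dots> = infsum ?R {-int L..int L}" by simp
  also have "\<dots> = infsum ?R UNIV"
    by (rule infsum_cong_neutral) (auto intro!: qtrinom_eq_0_of_gt)
  finally show ?thesis .
qed

end
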